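(* Let the symmetric group $\mathcal{S}_n$ act on $\mathbb{R}^n$ by permuting coordinates. The arrangement $\mathcal{A}(\mathcal{S}_n)$ associated with this action coincides with the rank $2$ truncation of the braid arrangement $\mathcal{A}_{n-1}$. In particular, the digitalization $Y_{\mathcal{A}(\mathcal{S}_n)}$ of this action coincides with the maximal De Concini–Procesi wonderful model of the braid arrangement.
   Context: The arrangement of a linear action: for a finite group $G$ acting linearly (orthogonally) and effectively on $\mathbb{R}^n$ and a subgroup $H\le G$, let $L(H)\subseteq\mathbb{R}^n$ be the linear span of all lines (one-dimensional linear subspaces) $\ell$ with $h\cdot\ell=\ell$ as a set for all $h\in H$. The arrangement $\mathcal{A}(G)$ is the family of the proper subspaces $L(H)\subsetneq\mathbb{R}^n$, $H\le G$. The braid arrangement is $\mathcal{A}_{n-1}=\{H_{ij}: 1\le i<j\le n\}$ with $H_{ij}=\{x\in\mathbb{R}^n: x_i=x_j\}$. For a set partition $\pi$ of $\{1,\ldots,n\}$, the braid space $U_\pi$ is the intersection of all $H_{ij}$ with $i,j$ in the same block of $\pi$; the braid spaces are exactly the intersections of hyperplanes of $\mathcal{A}_{n-1}$. The rank $2$ truncation of the braid arrangement is the braid arrangement without its hyperplanes, i.e. it consists of the braid spaces of codimension at least $2$. Maximal De Concini–Procesi wonderful model: for a finite family $\mathcal{A}$ of linear subspaces of a real vector space $V$, let $\mathcal{L}_{>\hat 0}$ be the set of all intersections of subspaces in $\mathcal{A}$ other than $V$ itself, and let $\mathcal{M}(\mathcal{A})=V\setminus\bigcup\mathcal{A}$.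 The maximal model $Y_{\mathcal{A}}$ is the closure of the image of the map $$\mathcal{M}(\mathcal{A})\to V\times\prod_{X\in\mathcal{L}_{>\hat 0}}\mathbb{P}(V/X),\qquad x\mapsto\big(x,(\langle x,X\rangle/X)_X\big),$$ where $\langle x,X\rangle$ denotes the linear span. Equivalently, it is the result of successively blowing up in $V$ the subspaces in $\mathcal{L}_{>\hat 0}$, respectively their proper transforms, in a linear extension of the inclusion order (smaller subspaces first). A digitalization of an action is a model with an extended action all of whose point stabilizers are elementary abelian $2$-groups; for an effective finite orthogonal action of $G$ on $\mathbb{R}^n$, the model $Y_{\mathcal{A}(G)}$ is such a digitalization.
   Formalization: The arrangement of S_n is compared with the rank 2 truncation through its family of proper intersections, because for n ≥ 5 the subspaces L(H) alone do not give every braid space of codimension at least 2 (for example 12|345 when n = 5). *)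

theory Defs
  imports "HOL-Analysis.Analysis" "HOL-Algebra.Group_Action"
begin

section \<open>The arrangement of a linear action\<close>

definition invariant_lines :: "('g \<Rightarrow> 'v \<Rightarrow> 'v) \<Rightarrow> 'g set \<Rightarrow> 'v::euclidean_space set set" where
  "invariant_lines act H = {l. subspace l \<and> dim l = 1 \<and> (\<forall>h\<in>H. act h ` l = l)}"

definition line_span :: "('g \<Rightarrow> 'v \<Rightarrow> 'v) \<Rightarrow> 'g set \<Rightarrow> 'v::euclidean_space set" where
  "line_span act H = span (\<Union> (invariant_lines act H))"

definition action_arrangement ::
    "'g monoid \<Rightarrow> ('g \<Rightarrow> 'v \<Rightarrow> 'v) \<Rightarrow> 'v::euclidean_space set set" where
  "action_arrangement G act = {line_span act H |H. subgroup H G \<and> line_span act H \<noteq> UNIV}"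

text \<open>The symmetric group on the index set \<open>'n\<close> is \<open>BijGroup UNIV\<close>, with composition of functions
  as multiplication. The inverse makes \<open>permute_coords\<close> a left action; it sends the unit vector
  of index \<open>i\<close> to that of index \<open>s i\<close>.\<close>

definition permute_coords :: "('n::finite \<Rightarrow> 'n) \<Rightarrow> real^'n \<Rightarrow> real^'n" where
  "permute_coords s x = (\<chi> i. x $ inv_into UNIV s i)"

definition symmetric_arrangement :: "(real^'n::finite) set set" where
  "symmetric_arrangement = action_arrangement (BijGroup (UNIV :: 'n set)) permute_coords"

section \<open>The braid arrangement\<close>

definition braid_hyperplane :: "'n::finite \<Rightarrow> 'n \<Rightarrow> (real^'n) set" where
  "braid_hyperplane i j = {x. x $ i = x $ j}"

definition braid_arrangement :: "(real^'n::finite) set set" where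
  "braid_arrangement = {braid_hyperplane i j |i j. i \<noteq> j}"

definition braid_space :: "'n::finite set set \<Rightarrow> (real^'n) set" where
  "braid_space P = \<Inter> {braid_hyperplane i j |i j. \<exists>B\<in>P. i \<in> B \<and> j \<in> B}"

definition rank2_truncation :: "(real^'n::finite) set set" where
  "rank2_truncation =
     {braid_space P |P. partition_on (UNIV :: 'n set) P \<and> dim (braid_space P) + 2 \<le> CARD('n)}"

section \<open>Intersections of an arrangement\<close>

text \<open>An arrangement is considered through its family of intersections (the space itself, i.e. the
  empty intersection, removed). A truncation of the braid arrangement is a truncation of this
  family, and it is in this sense that an arrangement coincides with one: the subspaces
  \<open>line_span permute_coords H\<close> themselves do not exhaust \<open>rank2_truncation\<close> when
  \<open>CARD('n) \<ge> 5\<close>. For example, the braid space of \<open>12|345\<close> is the intersection of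
  those of \<open>345\<close> and \<open>12|34\<close>, but it is not of the form \<open>line_span permute_coords H\<close>:
  such an \<open>H\<close> would preserve \<open>{1,2}\<close>, and hence the line spanned by the difference of the first two
  unit vectors, which is not contained in that braid space.\<close>

definition proper_intersections :: "'v set set \<Rightarrow> 'v set set" where
  "proper_intersections A = {\<Inter> B |B. B \<subseteq> A} - {UNIV}"

definition arrangement_complement :: "'v set set \<Rightarrow> 'v set" where
  "arrangement_complement A = UNIV - \<Union> A"

section \<open>The projective space of a quotient space\<close>

text \<open>For a subspace \<open>X \<subseteq> W\<close>, the quotient \<open>W/X\<close> is the set of cosets \<open>w + X\<close>.\<close>

definition quotient_space :: "'v::euclidean_space set \<Rightarrow> 'v set \<Rightarrow> 'v set set" where
  "quotient_space W X = (\<lambda>w. (+) w ` X) ` W"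

definition proj_quotient_points :: "'v::euclidean_space set \<Rightarrow> 'v set set set" where
  "proj_quotient_points X =
     {quotient_space W X |W. subspace W \<and> X \<subseteq> W \<and> dim W = dim X + 1}"

definition proj_class :: "'v::euclidean_space set \<Rightarrow> 'v \<Rightarrow> 'v set set" where
  "proj_class X x = quotient_space (span (insert x X)) X"

text \<open>The topology is the quotient topology with respect to the surjection \<open>proj_class X\<close> from the
  complement of \<open>X\<close>, see \<open>quotient_map_proj_class\<close>.\<close>

definition proj_quotient :: "'v::euclidean_space set \<Rightarrow> 'v set set topology" where
  "proj_quotient X = topology (\<lambda>U. U \<subseteq> proj_quotient_points X \<and>
     openin (top_of_set (- X)) {x \<in> - X. proj_class X x \<in> U})"

lemma openin_proj_quotient:
  "openin (proj_quotient X) U \<longleftrightarrow>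
     U \<subseteq> proj_quotient_points X \<and> openin (top_of_set (- X)) {x \<in> - X. proj_class X x \<in> U}"
proof -
  have "istopology (\<lambda>U. U \<subseteq> proj_quotient_points X \<and>
     openin (top_of_set (- X)) {x \<in> - X. proj_class X x \<in> U})" (is "istopology ?P")
    unfolding istopology_def
  proof (intro conjI allI impI)
    fix S T assume "?P S" "?P T"
    then show "S \<inter> T \<subseteq> proj_quotient_points X" by blast
    have "{x \<in> - X. proj_class X x \<in> S \<inter> T} =
      {x \<in> - X. proj_class X x \<in> S} \<inter> {x \<in> - X. proj_class X x \<in> T}" by blast
    then show "openin (top_of_set (- X)) {x \<in> - X. proj_class X x \<in> S \<inter> T}"
      using \<open>?P S\<close> \<open>?P T\<close> by (simp add: openin_Int)
  next
    fix K assume K: "\<forall>U\<in>K. ?P U"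
    then show "\<Union> K \<subseteq> proj_quotient_points X" by blast
    have "{x \<in> - X. proj_class X x \<in> \<Union> K} = (\<Union>U\<in>K. {x \<in> - X. proj_class X x \<in> U})" by blast
    then show "openin (top_of_set (- X)) {x \<in> - X. proj_class X x \<in> \<Union> K}"
      using K by (auto intro!: openin_Union)
  qed
  then show ?thesis
    unfolding proj_quotient_def by (simp add: topology_inverse')
qed

lemma proj_class_image:
  fixes X :: "'v::euclidean_space set"
  assumes X: "subspace X"
  shows "proj_class X ` (- X) = proj_quotient_points X"
proof (intro equalityI subsetI)
  fix p assume "p \<in> proj_class X ` (- X)"
  then obtain x where x: "x \<notin> X" "p = quotient_space (span (insert x X)) X"
    unfolding proj_class_def by blast
  have "x \<notin> span X"
    by (metis x(1) X span_eq_iff)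
  then have "dim (span (insert x X)) = dim X + 1"
    by (simp add: dim_insert)
  then show "p \<in> proj_quotient_points X"
    unfolding proj_quotient_points_def using x(2) subspace_span span_superset by blast
next
  fix p assume "p \<in> proj_quotient_points X"
  then obtain W where W: "p = quotient_space W X" "subspace W" "X \<subseteq> W" "dim W = dim X + 1"
    unfolding proj_quotient_points_def by blast
  have "W \<noteq> X" using W(4) by auto
  then obtain x where x: "x \<in> W" "x \<notin> X" using W(3) by blast
  have "x \<notin> span X"
    by (metis x(2) X span_eq_iff)
  have "span (insert x X) = W"
  proof (rule subspace_dim_equal)
    show "span (insert x X) \<subseteq> W" using x W by (simp add: span_minimal)
    show "dim W \<le> dim (span (insert x X))"
      using \<open>x \<notin> span X\<close> W(4) by (simp add: dim_insert)
  qed (use W in auto)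
  then show "p \<in> proj_class X ` (- X)"
    unfolding proj_class_def using x(2) W(1) by blast
qed

lemma topspace_proj_quotient:
  assumes "subspace X"
  shows "topspace (proj_quotient X) = proj_quotient_points X"
proof -
  have "{x \<in> - X. proj_class X x \<in> proj_quotient_points X} = - X"
    using proj_class_image[OF assms] by blast
  then have "openin (proj_quotient X) (proj_quotient_points X)"
    by (simp add: openin_proj_quotient)
  then show ?thesis
    by (metis openin_proj_quotient openin_subset openin_topspace subset_antisym)
qed

lemma quotient_map_proj_class:
  assumes "subspace X"
  shows "quotient_map (top_of_set (- X)) (proj_quotient X) (proj_class X)"
  unfolding quotient_map_def
  by (auto simp: topspace_proj_quotient[OF assms] proj_class_image[OF assms] openin_proj_quotient)

section \<open>Maximal wonderful models\<close>

definition model_ambient ::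
    "'v::euclidean_space set set \<Rightarrow> ('v \<times> ('v set \<Rightarrow> 'v set set)) topology" where
  "model_ambient A =
     prod_topology euclidean (product_topology proj_quotient (proper_intersections A))"

definition model_embedding ::
    "'v::euclidean_space set set \<Rightarrow> 'v \<Rightarrow> 'v \<times> ('v set \<Rightarrow> 'v set set)" where
  "model_embedding A x = (x, \<lambda>X \<in> proper_intersections A. proj_class X x)"

definition wonderful_model ::
    "'v::euclidean_space set set \<Rightarrow> ('v \<times> ('v set \<Rightarrow> 'v set set)) set" where
  "wonderful_model A = model_ambient A closure_of (model_embedding A ` arrangement_complement A)"

text \<open>The map induced on the ambient product by an automorphism \<open>f\<close> of the vector space that
  permutes the members of \<open>proper_intersections A\<close>. The component in the projective space of
  \<open>V/X\<close> is the image under \<open>f\<close> of the component at the preimage of \<open>X\<close>; it is a set of cosets,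
  hence the double image.\<close>

definition induced_map ::
    "'v::euclidean_space set set \<Rightarrow> ('v \<Rightarrow> 'v) \<Rightarrow>
     'v \<times> ('v set \<Rightarrow> 'v set set) \<Rightarrow> 'v \<times> ('v set \<Rightarrow> 'v set set)" where
  "induced_map A f = (\<lambda>(x, p). (f x, \<lambda>X \<in> proper_intersections A. (`) f ` p (f -` X)))"

definition model_action ::
    "'v::euclidean_space set set \<Rightarrow> ('g \<Rightarrow> 'v \<Rightarrow> 'v) \<Rightarrow> 'g \<Rightarrow>
     'v \<times> ('v set \<Rightarrow> 'v set set) \<Rightarrow> 'v \<times> ('v set \<Rightarrow> 'v set set)" where
  "model_action A act g = restrict (induced_map A (act g)) (wonderful_model A)"

definition elementary_abelian_2_group :: "('g, 'b) monoid_scheme \<Rightarrow> bool" where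
  "elementary_abelian_2_group G \<longleftrightarrow>
     comm_group G \<and> (\<forall>g\<in>carrier G. g \<otimes>\<^bsub>G\<^esub> g = \<one>\<^bsub>G\<^esub>)"

text \<open>The model of \<open>A\<close> is a digitalization of the action \<open>act\<close>: the action extends from the
  complement of the arrangement to a continuous action on the model, and the stabilizers of all
  points of the model are elementary abelian 2-groups.\<close>

definition is_digitalization ::
    "'g monoid \<Rightarrow> ('g \<Rightarrow> 'v \<Rightarrow> 'v) \<Rightarrow> 'v::euclidean_space set set \<Rightarrow> bool" where
  "is_digitalization G act A \<longleftrightarrow>
     group_action G (wonderful_model A) (model_action A act) \<and>
     (\<forall>g\<in>carrier G. continuous_map (subtopology (model_ambient A) (wonderful_model A))
        (subtopology (model_ambient A) (wonderful_model A)) (model_action A act g)) \<and>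
     (\<forall>g\<in>carrier G. \<forall>x\<in>arrangement_complement A. act g x \<in> arrangement_complement A \<and>
        model_action A act g (model_embedding A x) = model_embedding A (act g x)) \<and>
     (\<forall>y\<in>wonderful_model A.
        elementary_abelian_2_group (G\<lparr>carrier := stabilizer G (model_action A act) y\<rparr>))"

text \<open>The projection that keeps only the factors of the ambient product indexed by the proper
  intersections of \<open>A\<close>.\<close>

definition model_projection ::
    "'v::euclidean_space set set \<Rightarrow>
     'v \<times> ('v set \<Rightarrow> 'v set set) \<Rightarrow> 'v \<times> ('v set \<Rightarrow> 'v set set)" where
  "model_projection A = (\<lambda>(x, p). (x, restrict p (proper_intersections A)))"

text \<open>The models of \<open>A\<close> and \<open>B\<close> lie in different ambient products when \<open>B\<close> has additional
  hyperplanes among its proper intersections; each of these only contributes a factor that is a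
  single point. The models coincide under the identification of the ambient products that forgets
  these factors, and so do the induced actions.\<close>

definition models_coincide ::
    "'g monoid \<Rightarrow> ('g \<Rightarrow> 'v \<Rightarrow> 'v) \<Rightarrow> 'v::euclidean_space set set \<Rightarrow> 'v set set \<Rightarrow> bool" where
  "models_coincide G act A B \<longleftrightarrow>
     proper_intersections A \<subseteq> proper_intersections B \<and>
     homeomorphic_map (model_ambient B) (model_ambient A) (model_projection A) \<and>
     model_projection A ` wonderful_model B = wonderful_model A \<and>
     (\<forall>g\<in>carrier G. \<forall>y\<in>wonderful_model B. model_action B act g y \<in> wonderful_model B \<and>
        model_projection A (model_action B act g y) = model_action A act g (model_projection A y))"

end

theory Submission
  imports Defs "HOL-Algebra.Generated_Groups"
begin

text \<open>A line invariant under an orthogonal \<open>h\<close> consists of eigenvectors for \<open>1\<close> or \<open>-1\<close>. Hence \<open>L(H)\<close> is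
  the space of vectors fixed by all squares of elements of \<open>H\<close>. For permutations this is a braid
  space, and \<open>L(\<langle>s\<rangle>)\<close> is given by \<open>x\<^sub>i = x\<^sub>j = x\<^sub>k\<close> for the 3-cycle \<open>s = (i j k)\<close> and by \<open>x\<^sub>i = x\<^sub>j\<close>,
  \<open>x\<^sub>c = x\<^sub>d\<close> for the 4-cycle \<open>s = (i c j d)\<close>; the braid spaces of codimension at least 2 are
  intersections of these. Let \<open>H\<close> be the stabilizer of a point \<open>y\<close> of the model. If \<open>L(H)\<close> were proper,
  the component of \<open>y\<close> at \<open>L(H)\<close> would be a line of the quotient by \<open>L(H)\<close> fixed by \<open>H\<close>, so
  \<open>H\<close> would fix a line orthogonal to \<open>L(H)\<close>. Hence \<open>L(H)\<close> is the whole space and all squares in \<open>H\<close>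
  are trivial. Adding the hyperplanes only multiplies the ambient product by one-point factors, and
  the smaller complement is still dense.\<close>

section \<open>Linear and orthogonal group actions\<close>

locale linear_group_action = group G for G :: "'g monoid" (structure) +
  fixes act :: "'g \<Rightarrow> 'v::euclidean_space \<Rightarrow> 'v"
  assumes linear_act: "g \<in> carrier G \<Longrightarrow> linear (act g)"
    and act_one: "act \<one> x = x"
    and act_mult: "g \<in> carrier G \<Longrightarrow> h \<in> carrier G \<Longrightarrow> act (g \<otimes> h) x = act g (act h x)"
begin

lemma act_inv_act [simp]:
  assumes "g \<in> carrier G"
  shows "act (inv g) (act g x) = x" "act g (act (inv g) x) = x"
  using assms act_mult[of "inv g" g x] act_mult[of g "inv g" x] act_one by auto

lemma bij_act: "g \<in> carrier G \<Longrightarrow> bij (act g)"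
  by (rule bij_betw_byWitness[where f' = "act (inv g)"]) auto

lemma image_act_mult:
  "g \<in> carrier G \<Longrightarrow> h \<in> carrier G \<Longrightarrow> act (g \<otimes> h) ` X = act g ` act h ` X"
  by (auto simp: act_mult image_iff)

lemma image_act_inv [simp]:
  assumes "g \<in> carrier G"
  shows "act (inv g) ` act g ` X = X" "act g ` act (inv g) ` X = X"
  using assms by (simp_all add: image_image)

lemma vimage_act: "g \<in> carrier G \<Longrightarrow> act g -` X = act (inv g) ` X"
  by (auto simp: image_iff) (metis act_inv_act(1))

text \<open>Needed for \<open>g L(H) = L(g H g^-1)\<close>, by which G permutes its own arrangement:
  moving a line by g turns invariance under h into invariance under \<open>g h g^-1\<close>.\<close>

lemma invariant_lines_conjugate:
  assumes g: "g \<in> carrier G" and H: "subgroup H G"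
  shows "invariant_lines act ((\<lambda>h. g \<otimes> h \<otimes> inv g) ` H) = (`) (act g) ` invariant_lines act H"
    (is "?L = ?R")
proof
  have carr: "h \<in> carrier G" if "h \<in> H" for h
    using H that by (rule subgroup.mem_carrier)
  have conj: "act (g \<otimes> h \<otimes> inv g) ` X = act g ` act h ` act (inv g) ` X" if "h \<in> H" for h X
    using g carr[OF that] by (simp add: image_act_mult)
  have dim_image: "dim (act k ` X) = dim X" if "k \<in> carrier G" for k X
    using that linear_act bij_act by (metis bij_is_inj dim_image_eq inj_on_subset subset_UNIV)
  show "?R \<subseteq> ?L"
  proof (clarify)
    fix l assume l: "l \<in> invariant_lines act H"
    then have "act (g \<otimes> h \<otimes> inv g) ` act g ` l = act g ` l" if "h \<in> H" for h
      using that g conj[OF that] by (simp add: invariant_lines_def)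
    then show "act g ` l \<in> ?L"
      using l g dim_image linear_act by (auto simp: invariant_lines_def linear_subspace_image)
  qed
  show "?L \<subseteq> ?R"
  proof
    fix l assume l: "l \<in> ?L"
    have "act h ` act (inv g) ` l = act (inv g) ` l" if "h \<in> H" for h
    proof -
      have "act g ` act h ` act (inv g) ` l = l"
        using l that conj by (auto simp: invariant_lines_def)
      then show ?thesis
        using g by (metis image_act_inv(1))
    qed
    then have "act (inv g) ` l \<in> invariant_lines act H"
      using l g dim_image linear_act
      by (auto simp: invariant_lines_def linear_subspace_image)
    then show "l \<in> ?R"
      using g by (metis image_act_inv(2) image_eqI)
  qed
qed

lemma image_line_span:
  assumes "g \<in> carrier G" "subgroup H G"
  shows "act g ` line_span act H = line_span act ((\<lambda>h. g \<otimes> h \<otimes> inv g) ` H)"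
  unfolding line_span_def invariant_lines_conjugate[OF assms]
  using linear_span_image[OF linear_act] assms(1) by (metis image_Union)

lemma subgroup_conjugate:
  assumes g: "g \<in> carrier G" and H: "subgroup H G"
  shows "subgroup ((\<lambda>h. g \<otimes> h \<otimes> inv g) ` H) G"
proof -
  have "group_hom G G (\<lambda>h. g \<otimes> h \<otimes> inv g)"
  proof (unfold_locales, rule homI)
    fix x y assume "x \<in> carrier G" "y \<in> carrier G"
    then show "g \<otimes> (x \<otimes> y) \<otimes> inv g = g \<otimes> x \<otimes> inv g \<otimes> (g \<otimes> y \<otimes> inv g)"
      using g by (simp add: m_assoc) (simp add: m_assoc[symmetric])
  qed (use g in auto)
  then show ?thesis
    using H by (rule group_hom.subgroup_img_is_subgroup)
qed

lemma action_arrangement_invariant: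
  assumes g: "g \<in> carrier G" and X: "X \<in> action_arrangement G act"
  shows "act g ` X \<in> action_arrangement G act"
proof -
  obtain H where H: "X = line_span act H" "subgroup H G" "X \<noteq> UNIV"
    using X unfolding action_arrangement_def by blast
  have "act g ` X \<noteq> UNIV"
    using H(3) g bij_act by (metis bij_vimage_eq_inv_image image_act_inv(1) vimage_UNIV vimage_act)
  then show ?thesis
    unfolding action_arrangement_def
    using H image_line_span[OF g H(2)] subgroup_conjugate[OF g H(2)] by auto
qed

end

section \<open>Orthogonal actions: line spans and vectors fixed by squares\<close>

locale orthogonal_group_action = linear_group_action +
  assumes inner_act: "g \<in> carrier G \<Longrightarrow> act g x \<bullet> act g y = x \<bullet> y"
begin

lemma subspace_act_square_fixed:
  assumes "h \<in> carrier G"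
  shows "subspace {x. act h (act h x) = x}"
  using linear_act[OF assms] by (auto simp: subspace_def linear_add linear_cmul linear_0)

lemma act_square_fixes_line_span:
  assumes h: "h \<in> H" "h \<in> carrier G" and x: "x \<in> line_span act H"
  shows "act h (act h x) = x"
proof -
  have "v \<in> {x. act h (act h x) = x}" if v: "v \<in> \<Union> (invariant_lines act H)" for v
  proof (cases "v = 0")
    case True
    then show ?thesis using linear_act[OF h(2)] by (simp add: linear_0)
  next
    case False
    obtain l where l: "v \<in> l" "subspace l" "dim l = 1" "act h ` l = l"
      using h v by (auto simp: invariant_lines_def)
    have "span {v} = l"
      using l False span_minimal[of "{v}" l] by (intro subspace_dim_equal) auto
    then have "act h v \<in> span {v}"
      using l by blast
    then obtain c where c: "act h v = c *\<^sub>R v"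
      by (auto simp: span_singleton)
    \<comment> \<open>h preserves the norm of the nonzero vector v, so its eigenvalue is 1 or -1 and
      its square fixes v.\<close>
    have "c * c = 1"
      using inner_act[OF h(2), of v v] False by (simp add: c)
    then show ?thesis
      using c linear_act[OF h(2)] by (simp add: linear_cmul)
  qed
  then have "line_span act H \<subseteq> {x. act h (act h x) = x}"
    unfolding line_span_def using subspace_act_square_fixed[OF h(2)] by (intro span_minimal) auto
  then show ?thesis using x by blast
qed

text \<open>The way into L(H): a nonzero common eigenvector spans an invariant line. The zero vector
  is treated separately because it spans no line.\<close>

lemma eigenvector_in_line_span:
  assumes H: "H \<subseteq> carrier G" and w: "\<And>h. h \<in> H \<Longrightarrow> act h w = w \<or> act h w = - w"
  shows "w \<in> line_span act H"
proof (cases "w = 0")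
  case True
  then show ?thesis by (simp add: line_span_def span_zero)
next
  case False
  have "act h ` span {w} = span {w}" if "h \<in> H" for h
  proof -
    have "act h ` span {w} = span {act h w}"
      using that H linear_act by (metis image_empty image_insert linear_span_image subsetD)
    also have "\<dots> = span {w}"
    proof -
      have "w \<in> span {- w}"
        using span_neg[OF span_base[of "- w" "{- w}"]] by simp
      then have "span {- w} = span {w}"
        by (intro antisym span_minimal) (auto simp: span_neg span_base)
      then show ?thesis using w[OF that] by metis
    qed
    finally show ?thesis .
  qed
  then have "span {w} \<in> invariant_lines act H"
    using False by (simp add: invariant_lines_def)
  then show ?thesis
    unfolding line_span_def by (intro span_base UnionI[of "span {w}"]) (auto simp: span_base)
qed

text \<open>The group generated by the images of \<open>H\<close> on the subspace fixed by all squares is an elementary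
  abelian 2-group, so that its elements are simultaneously diagonalizable.\<close>

lemma line_span_eq_fixed_by_squares:
  assumes H: "subgroup H G" and fin: "finite H"
  shows "line_span act H = {x. \<forall>h\<in>H. act h (act h x) = x}"
proof (intro equalityI subsetI)
  fix x assume "x \<in> line_span act H"
  then show "x \<in> {x. \<forall>h\<in>H. act h (act h x) = x}"
    using act_square_fixes_line_span subgroup.mem_carrier[OF H] by blast
next
  define W where "W = {x. \<forall>h\<in>H. act h (act h x) = x}"
  have carr: "h \<in> carrier G" if "h \<in> H" for h
    using H that by (rule subgroup.mem_carrier)
  note lin = linear_act[OF carr]
  have square: "act h (act h w) = w" if "h \<in> H" "w \<in> W" for h w
    using that by (simp add: W_def)
  have "W = (\<Inter>h\<in>H. {x. act h (act h x) = x})"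
    by (auto simp: W_def)
  then have subspace: "subspace W"
    using subspace_act_square_fixed[OF carr] by (simp add: subspace_Inter)
  have stable: "act g w \<in> W" if "g \<in> H" "w \<in> W" for g w
    unfolding W_def
  proof (intro CollectI ballI)
    fix h assume h: "h \<in> H"
    \<comment> \<open>Moving h past g replaces it by a conjugate in H, whose square also fixes w;
      hence W is stable under H.\<close>
    let ?k = "inv g \<otimes> h \<otimes> g"
    have k: "?k \<in> H"
      using H \<open>g \<in> H\<close> h by (simp add: subgroup.m_closed subgroup.m_inv_closed)
    have "act h (act g v) = act g (act ?k v)" for v
      using \<open>g \<in> H\<close> h carr by (simp add: act_mult)
    then show "act h (act h (act g w)) = act g w"
      using square[OF k \<open>w \<in> W\<close>] by simp
  qed
  \<comment> \<open>On W all of H acts by involutions, and involutions whose products are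
    involutions commute.\<close>
  have commute: "act g (act h w) = act h (act g w)" if gh: "g \<in> H" "h \<in> H" and w: "w \<in> W" for g h w
  proof -
    have "act h (act g (act h (act g w))) = w"
      using square[of "h \<otimes> g" w] gh w carr H by (simp add: act_mult subgroup.m_closed)
    then have "act g (act h (act g w)) = act h w"
      using square[of h "act g (act h (act g w))"] gh w stable by simp
    then show ?thesis
      using square[of g "act h (act g w)"] gh w stable by simp
  qed
  \<comment> \<open>The simultaneous eigenvectors in W of the elements of F, for the eigenvalues 1
    and -1. Induction on F shows that x lies in their span; the case \<open>F = H\<close> is the one
    wanted.\<close>
  define E where "E F = {w \<in> W. \<forall>h\<in>F. act h w = w \<or> act h w = - w}" for F
  fix x assume "x \<in> {x. \<forall>h\<in>H. act h (act h x) = x}"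
  then have x: "x \<in> W" by (simp add: W_def)
  have "x \<in> span (E F)" if "F \<subseteq> H" for F
    using finite_subset[OF that fin] that
  proof (induction F rule: finite_induct)
    case empty
    then show ?case using x by (simp add: E_def span_base)
  next
    case (insert h F)
    have h: "h \<in> H" and F: "F \<subseteq> H" using insert.prems by auto
    have "w \<in> span (E (insert h F))" if w: "w \<in> E F" for w
    proof -
      have wW: "w \<in> W" using w by (simp add: E_def)
      \<comment> \<open>Since h commutes with g on W, \<open>act h w\<close> lies in the same
        eigenspace of g as w. So \<open>w + act h w\<close> and \<open>w - act h w\<close> remain
        eigenvectors for F, while h acts on them by 1 and -1; w is half their sum.\<close>
      have signs: "act g w = w \<and> act g (act h w) = act h w
          \<or> act g w = - w \<and> act g (act h w) = - act h w" if "g \<in> F" for g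
        using that F w h lin commute[of g h w] wW by (auto simp: E_def linear_neg subset_iff)
      have "w + act h w \<in> E (insert h F)" "w - act h w \<in> E (insert h F)"
        using signs F h square[OF h wW] lin stable[OF h wW] wW subspace
        by (fastforce simp: E_def linear_add linear_diff subset_iff subspace_add subspace_diff)+
      then have "(1/2) *\<^sub>R ((w + act h w) + (w - act h w)) \<in> span (E (insert h F))"
        by (intro span_scale span_add span_base)
      then show ?thesis by (simp add: scaleR_2[symmetric])
    qed
    then have "span (E F) \<subseteq> span (E (insert h F))"
      by (intro span_minimal) auto
    then show ?case using insert.IH F by auto
  qed
  from this[of H] have "x \<in> span (E H)"
    by simp
  moreover have "span (E H) \<subseteq> line_span act H"
    using eigenvector_in_line_span[of H] carr
    by (intro span_minimal) (auto simp: line_span_def E_def)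
  ultimately show "x \<in> line_span act H" by blast
qed

text \<open>A vector fixed by the square of g is half the sum of the eigenvectors
  \<open>x + act g x\<close> and \<open>x - act g x\<close>, and an eigenvector of g for 1 or -1 is
  one for the whole group generated by g. This produces members of the arrangement from single group
  elements.\<close>

lemma line_span_cyclic:
  assumes g: "g \<in> carrier G"
  shows "line_span act (generate G {g}) = {x. act g (act g x) = x}"
proof (intro equalityI subsetI)
  fix x assume "x \<in> line_span act (generate G {g})"
  then show "x \<in> {x. act g (act g x) = x}"
    using g act_square_fixes_line_span[of g] generate.incl[of g "{g}" G] by blast
next
  fix x assume "x \<in> {x. act g (act g x) = x}"
  then have x: "act g (act g x) = x" by simp
  have sub: "subgroup {h \<in> carrier G. act h w = w \<or> act h w = - w} G" for w
  proof
    fix h k assume "h \<in> {h \<in> carrier G. act h w = w \<or> act h w = - w}"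
      "k \<in> {h \<in> carrier G. act h w = w \<or> act h w = - w}"
    then show "h \<otimes> k \<in> {h \<in> carrier G. act h w = w \<or> act h w = - w}"
      using linear_act[of h] by (auto simp: act_mult linear_neg)
  next
    fix h assume "h \<in> {h \<in> carrier G. act h w = w \<or> act h w = - w}"
    then have h: "h \<in> carrier G" "act h w = w \<or> act h w = - w" by auto
    then have "act (inv h) w = w \<or> act (inv h) w = - w"
      using linear_neg[OF linear_act, of "inv h" w] by (metis act_inv_act(1) inv_closed minus_minus)
    then show "inv h \<in> {h \<in> carrier G. act h w = w \<or> act h w = - w}"
      using h by auto
  qed (auto simp: act_one)
  have "w \<in> line_span act (generate G {g})" if "act g w = w \<or> act g w = - w" for w
  proof (rule eigenvector_in_line_span)
    show "generate G {g} \<subseteq> carrier G"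
      using g by (simp add: generate_incl)
    have "generate G {g} \<subseteq> {h \<in> carrier G. act h w = w \<or> act h w = - w}"
      using that g sub by (intro generate_subgroup_incl) auto
    then show "act h w = w \<or> act h w = - w" if "h \<in> generate G {g}" for h
      using that by blast
  qed
  then have "x + act g x \<in> line_span act (generate G {g})"
    "x - act g x \<in> line_span act (generate G {g})"
    using x linear_act[OF g] by (auto simp: linear_add linear_diff)
  then have "(1/2) *\<^sub>R ((x + act g x) + (x - act g x)) \<in> line_span act (generate G {g})"
    unfolding line_span_def by (rule span_scale[OF span_add])
  then show "x \<in> line_span act (generate G {g})"
    by (simp add: scaleR_2[symmetric])
qed

end

section \<open>Projective spaces of quotients and wonderful models\<close>

text \<open>Linearity takes the coset \<open>w + X\<close> to \<open>f w + f X\<close> and the span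
  of x and X to that of their images. This is the source of the equivariance of
  \<open>model_embedding\<close>.\<close>

lemma image_proj_class:
  assumes "linear f"
  shows "(`) ((`) f) (proj_class X x) = proj_class (f ` X) (f x)"
proof -
  have "f ` (+) w ` X = (+) (f w) ` f ` X" for w
    using assms by (auto simp: image_iff linear_add)
  moreover have "span (insert (f x) (f ` X)) = f ` span (insert x X)"
    by (metis assms image_insert linear_span_image)
  ultimately show ?thesis
    unfolding proj_class_def quotient_space_def
    by (simp only: image_image[of "(`) f" "\<lambda>w. (+) w ` X"] image_image[of "\<lambda>w. (+) w ` f ` X" f])
qed

lemma continuous_map_proj_class:
  assumes "subspace X"
  shows "continuous_map (top_of_set (- X)) (proj_quotient X) (proj_class X)"
  by (rule quotient_imp_continuous_map[OF quotient_map_proj_class[OF assms]])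

lemma continuous_map_image_proj_quotient:
  fixes f :: "'v::euclidean_space \<Rightarrow> 'v"
  assumes X: "subspace X" and f: "linear f" "inj f"
  shows "continuous_map (proj_quotient X) (proj_quotient (f ` X)) ((`) ((`) f))"
proof -
  have "continuous_map (top_of_set (- X)) (top_of_set (- (f ` X))) f"
    using f by (auto simp: linear_continuous_on linear_linear inj_image_mem_iff)
  then have "continuous_map (top_of_set (- X)) (proj_quotient (f ` X)) (proj_class (f ` X) \<circ> f)"
    using continuous_map_proj_class[OF linear_subspace_image[OF f(1) X]]
    by (rule continuous_map_compose)
  then have "continuous_map (top_of_set (- X)) (proj_quotient (f ` X)) ((`) ((`) f) \<circ> proj_class X)"
    by (simp add: image_proj_class[OF f(1)] o_def)
  then show ?thesis
    using continuous_compose_quotient_map_eq[OF quotient_map_proj_class[OF X]] by blast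
qed

text \<open>Only the whole space is one dimension larger than a hyperplane. This is why hyperplanes
  add nothing to a model.\<close>

lemma proj_quotient_points_hyperplane:
  fixes X :: "'v::euclidean_space set"
  assumes "dim X + 1 = DIM('v)"
  shows "proj_quotient_points X = {quotient_space UNIV X}"
proof -
  have "W = UNIV" if "subspace W" "dim W = dim X + 1" for W :: "'v set"
    using that assms by (metis dim_eq_full span_eq_iff)
  then show ?thesis
    using assms by (auto simp: proj_quotient_points_def)
qed

lemma subspace_proper_intersection:
  assumes "\<And>X. X \<in> A \<Longrightarrow> subspace X" "X \<in> proper_intersections A"
  shows "subspace X"
proof -
  obtain B where "B \<subseteq> A" "X = \<Inter> B"
    using assms(2) unfolding proper_intersections_def by blast
  then show ?thesis
    using assms(1) by (auto intro!: subspace_Inter)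
qed

lemma proper_intersection_subset_member:
  assumes "X \<in> proper_intersections A"
  obtains Y where "Y \<in> A" "X \<subseteq> Y"
  using assms unfolding proper_intersections_def by blast

text \<open>Allows complements of two arrangements to be compared through their families of
  intersections.\<close>

lemma Union_proper_intersections:
  assumes "UNIV \<notin> A"
  shows "\<Union> (proper_intersections A) = \<Union> A"
proof
  show "\<Union> (proper_intersections A) \<subseteq> \<Union> A"
    by (auto elim: proper_intersection_subset_member)
  have "X \<in> proper_intersections A" if "X \<in> A" for X
    using that assms unfolding proper_intersections_def
    by (auto intro!: exI[of _ "{X}"])
  then show "\<Union> A \<subseteq> \<Union> (proper_intersections A)"
    by blast
qed

lemma topspace_model_ambient:
  assumes "\<And>X. X \<in> A \<Longrightarrow> subspace X"
  shows "topspace (model_ambient A) =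
    UNIV \<times> (\<Pi>\<^sub>E X \<in> proper_intersections A. proj_quotient_points X)"
  unfolding model_ambient_def topspace_prod_topology topspace_product_topology
  using subspace_proper_intersection[OF assms]
  by (auto simp: PiE_iff topspace_proj_quotient)

lemma wonderful_model_subset_topspace: "wonderful_model A \<subseteq> topspace (model_ambient A)"
  unfolding wonderful_model_def by (rule closure_of_subset_topspace)

lemma continuous_map_model_ambient_iff:
  "continuous_map T (model_ambient A) f \<longleftrightarrow>
     continuous_map T euclidean (fst \<circ> f) \<and> (snd \<circ> f) ` topspace T \<subseteq> extensional (proper_intersections A) \<and>
     (\<forall>X\<in>proper_intersections A. continuous_map T (proj_quotient X) (\<lambda>y. snd (f y) X))"
  unfolding model_ambient_def continuous_map_pairwise continuous_map_componentwise
  by (simp add: o_def)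

lemma continuous_map_model_ambient_fst: "continuous_map (model_ambient A) euclidean fst"
  unfolding model_ambient_def by (rule continuous_map_fst)

lemma continuous_map_model_ambient_component:
  assumes "X \<in> proper_intersections A"
  shows "continuous_map (model_ambient A) (proj_quotient X) (\<lambda>y. snd y X)"
  using continuous_map_compose[OF continuous_map_snd continuous_map_product_projection[OF assms]]
  unfolding model_ambient_def by (simp add: o_def)

lemma continuous_map_model_embedding:
  assumes A: "\<And>X. X \<in> A \<Longrightarrow> subspace X"
  shows "continuous_map (top_of_set (arrangement_complement A)) (model_ambient A) (model_embedding A)"
  unfolding continuous_map_model_ambient_iff
proof (intro conjI ballI)
  fix X assume X: "X \<in> proper_intersections A"
  have "arrangement_complement A \<subseteq> - X"
    using proper_intersection_subset_member[OF X] unfolding arrangement_complement_def by blast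
  then have "continuous_map (top_of_set (arrangement_complement A)) (proj_quotient X) (proj_class X)"
    by (metis continuous_map_from_subtopology_mono continuous_map_proj_class
        subspace_proper_intersection[OF A X])
  then show "continuous_map (top_of_set (arrangement_complement A)) (proj_quotient X)
      (\<lambda>y. snd (model_embedding A y) X)"
    using X by (simp add: model_embedding_def)
qed (auto simp: model_embedding_def o_def)

lemma model_embedding_in_wonderful_model:
  assumes A: "\<And>X. X \<in> A \<Longrightarrow> subspace X" and x: "x \<in> arrangement_complement A"
  shows "model_embedding A x \<in> wonderful_model A"
proof -
  have "model_embedding A ` arrangement_complement A \<subseteq> topspace (model_ambient A)"
    using continuous_map_image_subset_topspace[OF continuous_map_model_embedding[OF A]] by simp
  then show ?thesis
    unfolding wonderful_model_def using x closure_of_subset by blast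
qed

text \<open>Finitely many proper subspaces have a union of measure zero, which has empty
  interior.\<close>

lemma closure_arrangement_complement:
  fixes A :: "'v::euclidean_space set set"
  assumes "finite A" "\<And>X. X \<in> A \<Longrightarrow> subspace X" "UNIV \<notin> A"
  shows "closure (arrangement_complement A) = UNIV"
proof -
  have "negligible X" if "X \<in> A" for X
  proof (rule negligible_lowdim)
    have "X \<noteq> UNIV" using that assms(3) by metis
    then have "dim X \<noteq> DIM('v)"
      using assms(2)[OF that] by (metis dim_eq_full span_eq_iff)
    then show "dim X < DIM('v)"
      using dim_subset_UNIV[of X] by linarith
  qed
  then have "negligible (\<Union> A)"
    using assms(1) by (intro negligible_Union) auto
  then have "interior (\<Union> A) = {}"
    by (meson interior_subset negligible_subset open_interior open_not_negligible)
  then show ?thesis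
    unfolding arrangement_complement_def by (simp add: closure_interior Compl_eq_Diff_UNIV[symmetric])
qed

section \<open>Extension of linear actions to wonderful models\<close>

locale invariant_arrangement = linear_group_action G act
  for G :: "'g monoid" (structure) and act :: "'g \<Rightarrow> 'v::euclidean_space \<Rightarrow> 'v" +
  fixes A :: "'v set set"
  assumes subspace_member: "X \<in> A \<Longrightarrow> subspace X"
    and invariant_member: "g \<in> carrier G \<Longrightarrow> X \<in> A \<Longrightarrow> act g ` X \<in> A"
begin

text \<open>\<open>induced_map\<close> reads the component at the preimage of X, which must
  therefore be an index again. Preimages under g are images under its inverse.\<close>

lemma vimage_proper_intersection:
  assumes g: "g \<in> carrier G" and X: "X \<in> proper_intersections A"
  shows "act g -` X \<in> proper_intersections A"
proof -
  obtain B where B: "B \<subseteq> A" "X = \<Inter> B" "X \<noteq> UNIV"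
    using X unfolding proper_intersections_def by blast
  have "act g -` X = \<Inter> ((-`) (act g) ` B)"
    using B(2) by auto
  moreover have "(-`) (act g) ` B \<subseteq> A"
    using B(1) g by (auto simp: vimage_act invariant_member)
  moreover have "act g -` X \<noteq> UNIV"
    using B(3) g by (metis UNIV_I UNIV_eq_I act_inv_act(2) vimageD)
  ultimately show ?thesis
    unfolding proper_intersections_def by blast
qed

lemma act_arrangement_complement:
  assumes "g \<in> carrier G" "x \<in> arrangement_complement A"
  shows "act g x \<in> arrangement_complement A"
proof -
  have "x \<in> \<Union> A" if "X \<in> A" "act g x \<in> X" for X
    using that assms(1) invariant_member[of "inv g" X] by (metis UnionI act_inv_act(1) imageI inv_closed)
  then show ?thesis
    using assms(2) unfolding arrangement_complement_def by blast
qed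

lemma induced_map_model_embedding:
  assumes "g \<in> carrier G"
  shows "induced_map A (act g) (model_embedding A x) = model_embedding A (act g x)"
proof -
  have "(`) ((`) (act g)) (proj_class (act g -` X) x) = proj_class X (act g x)" for X
    using bij_is_surj[OF bij_act[OF assms]] by (simp add: image_proj_class[OF linear_act[OF assms]])
  then show ?thesis
    using vimage_proper_intersection[OF assms]
    by (simp add: induced_map_def model_embedding_def cong: restrict_cong)
qed

lemma continuous_map_induced_map:
  assumes g: "g \<in> carrier G"
  shows "continuous_map (model_ambient A) (model_ambient A) (induced_map A (act g))"
  unfolding continuous_map_model_ambient_iff
proof (intro conjI ballI)
  have "continuous_map (model_ambient A) euclidean (act g \<circ> fst)"
    using linear_act[OF g] continuous_map_model_ambient_fst
    by (intro continuous_map_compose) (auto simp: linear_continuous_on linear_linear)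
  then show "continuous_map (model_ambient A) euclidean (fst \<circ> induced_map A (act g))"
    by (simp add: induced_map_def o_def case_prod_beta)
next
  fix X assume X: "X \<in> proper_intersections A"
  \<comment> \<open>The new component at X is the old one at the preimage of X, followed by a
    continuous map between the two projective spaces.\<close>
  let ?Z = "act g -` X"
  have Z: "?Z \<in> proper_intersections A" using g X by (rule vimage_proper_intersection)
  have "act g ` ?Z = X"
    using bij_act[OF g] by (simp add: bij_is_surj)
  then have "continuous_map (proj_quotient ?Z) (proj_quotient X) ((`) ((`) (act g)))"
    using continuous_map_image_proj_quotient[OF _ linear_act[OF g] bij_is_inj[OF bij_act[OF g]], of ?Z]
      subspace_proper_intersection[OF subspace_member Z] by simp
  with continuous_map_model_ambient_component[OF Z]
  have "continuous_map (model_ambient A) (proj_quotient X) ((`) ((`) (act g)) \<circ> (\<lambda>y. snd y ?Z))"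
    by (rule continuous_map_compose)
  then show "continuous_map (model_ambient A) (proj_quotient X) (\<lambda>y. snd (induced_map A (act g) y) X)"
    using X by (simp add: induced_map_def o_def case_prod_beta)
qed (auto simp: induced_map_def)

text \<open>A continuous self-map of the ambient product that preserves the embedded complement
  preserves its closure.\<close>

lemma induced_map_wonderful_model:
  assumes g: "g \<in> carrier G" and y: "y \<in> wonderful_model A"
  shows "induced_map A (act g) y \<in> wonderful_model A"
proof -
  have "induced_map A (act g) ` model_embedding A ` arrangement_complement A
      \<subseteq> model_embedding A ` arrangement_complement A"
    using act_arrangement_complement[OF g] by (auto simp: induced_map_model_embedding[OF g])
  then show ?thesis
    using y continuous_map_image_closure_subset[OF continuous_map_induced_map[OF g]]
    unfolding wonderful_model_def by (meson closure_of_mono image_subset_iff order_trans subsetD)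
qed

lemma induced_map_mult:
  assumes g: "g \<in> carrier G" and h: "h \<in> carrier G"
  shows "induced_map A (act (g \<otimes> h)) y = induced_map A (act g) (induced_map A (act h) y)"
proof -
  have image: "(`) (act (g \<otimes> h)) = (\<lambda>S. act g ` act h ` S)"
    using image_act_mult[OF assms] by blast
  \<comment> \<open>Preimages reverse the order of composition, which matches g acting after h in a
    left action.\<close>
  have vimage: "act (g \<otimes> h) -` X = act h -` act g -` X" for X
    by (auto simp: act_mult[OF assms])
  show ?thesis
    using vimage_proper_intersection[OF g]
    by (simp add: induced_map_def case_prod_beta act_mult[OF assms] image vimage image_comp o_def
        cong: restrict_cong)
qed

text \<open>The induced map restricts p to the indices, so it gives p back only when p is
  extensional; membership in the ambient space guarantees this.\<close>

lemma induced_map_one: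
  assumes "y \<in> topspace (model_ambient A)"
  shows "induced_map A (act \<one>) y = y"
proof -
  have "act \<one> = id"
    by (auto simp: act_one)
  moreover have "snd y \<in> extensional (proper_intersections A)"
    using assms by (auto simp: topspace_model_ambient[OF subspace_member] PiE_def)
  ultimately show ?thesis
    by (simp add: induced_map_def case_prod_beta extensional_restrict id_def)
qed

lemma model_action_eq: "y \<in> wonderful_model A \<Longrightarrow> model_action A act g y = induced_map A (act g) y"
  by (simp add: model_action_def)

lemma group_action_model_action: "group_action G (wonderful_model A) (model_action A act)"
proof -
  have one: "induced_map A (act \<one>) y = y" if "y \<in> wonderful_model A" for y
    using that wonderful_model_subset_topspace induced_map_one by blast
  have "bij_betw (model_action A act g) (wonderful_model A) (wonderful_model A)"
    if g: "g \<in> carrier G" for g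
    by (rule bij_betw_byWitness[where f' = "model_action A act (inv g)"])
      (use g one induced_map_mult[of g "inv g", symmetric] induced_map_mult[of "inv g" g, symmetric] in
        \<open>auto simp: model_action_eq induced_map_wonderful_model\<close>)
  \<comment> \<open>\<open>Bij\<close> consists of extensional functions, hence the restriction to
    the model in \<open>model_action\<close>.\<close>
  then have Bij: "model_action A act g \<in> Bij (wonderful_model A)" if "g \<in> carrier G" for g
    using that by (simp add: Bij_def model_action_def)
  show ?thesis
    unfolding group_action_def group_hom_def group_hom_axioms_def
  proof (intro conjI homI)
    fix g h assume gh: "g \<in> carrier G" "h \<in> carrier G"
    have "model_action A act (g \<otimes> h) = compose (wonderful_model A) (model_action A act g) (model_action A act h)"
      by (auto simp: fun_eq_iff model_action_def compose_def induced_map_mult[OF gh]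
          induced_map_wonderful_model gh)
    then show "model_action A act (g \<otimes> h)
        = model_action A act g \<otimes>\<^bsub>BijGroup (wonderful_model A)\<^esub> model_action A act h"
      using Bij gh by (simp add: BijGroup_def)
  qed (use Bij group_BijGroup is_group in \<open>auto simp: BijGroup_def\<close>)
qed

lemma continuous_map_model_action:
  assumes g: "g \<in> carrier G"
  shows "continuous_map (subtopology (model_ambient A) (wonderful_model A))
    (subtopology (model_ambient A) (wonderful_model A)) (model_action A act g)"
proof -
  have "continuous_map (subtopology (model_ambient A) (wonderful_model A))
      (subtopology (model_ambient A) (wonderful_model A)) (induced_map A (act g))"
    using continuous_map_induced_map[OF g] induced_map_wonderful_model[OF g]
    by (auto simp: continuous_map_in_subtopology continuous_map_from_subtopology)
  then show ?thesis
    by (rule continuous_map_eq) (simp add: model_action_eq)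
qed

lemma model_action_model_embedding:
  assumes "g \<in> carrier G" "x \<in> arrangement_complement A"
  shows "model_action A act g (model_embedding A x) = model_embedding A (act g x)"
  using assms model_embedding_in_wonderful_model[OF subspace_member]
  by (simp add: model_action_eq induced_map_model_embedding)

end

section \<open>Stabilizers of points of the model\<close>

lemma (in group) comm_group_of_squares_one:
  assumes square: "\<And>x. x \<in> carrier G \<Longrightarrow> x \<otimes> x = \<one>"
  shows "comm_group G"
proof (rule group_comm_groupI)
  have inv: "inv x = x" if "x \<in> carrier G" for x
    using that square by (intro inv_equality)
  fix x y assume "x \<in> carrier G" "y \<in> carrier G"
  then show "x \<otimes> y = y \<otimes> x"
    by (metis inv inv_mult_group m_closed)
qed

text \<open>Leads back from sets of cosets to subspaces: the coset of v contains v, so v is a sum of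
  two vectors of W.\<close>

lemma quotient_space_eq_imp_subset:
  assumes "subspace X" "quotient_space V X = quotient_space W X" "subspace W" "X \<subseteq> W"
  shows "V \<subseteq> W"
proof
  fix v assume v: "v \<in> V"
  then have "(+) v ` X \<in> quotient_space W X"
    using assms(2) unfolding quotient_space_def by blast
  then obtain w where w: "w \<in> W" "(+) v ` X = (+) w ` X"
    unfolding quotient_space_def by blast
  have "v + 0 \<in> (+) v ` X" using assms(1) by (intro imageI subspace_0)
  then obtain x where "x \<in> X" "v = w + x" using w(2) by auto
  then show "v \<in> W" using w(1) assms(3,4) by (auto intro: subspace_add)
qed

context orthogonal_group_action
begin

lemma image_act_line_span:
  assumes "h \<in> H" "h \<in> carrier G"
  shows "act h ` line_span act H = line_span act H"
proof -
  have "(`) (act h) ` invariant_lines act H = invariant_lines act H"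
    using assms(1) by (auto simp: invariant_lines_def image_iff)
  then show ?thesis
    unfolding line_span_def using linear_span_image[OF linear_act[OF assms(2)]]
    by (metis image_Union)
qed

text \<open>L(H) has absorbed every line preserved by H, so none can be left in the quotient:
  orthogonality would lift it to a preserved line orthogonal to L(H).\<close>

lemma no_fixed_proj_quotient_point:
  assumes H: "H \<subseteq> carrier G"
    and p: "p \<in> proj_quotient_points (line_span act H)"
    and fixed: "\<And>h. h \<in> H \<Longrightarrow> (`) ((`) (act h)) p = p"
  shows False
proof -
  define X where "X = line_span act H"
  have X: "subspace X" by (simp add: X_def line_span_def)
  obtain w where w: "w \<notin> X" "p = proj_class X w"
    using p proj_class_image[OF X] unfolding X_def by blast
  \<comment> \<open>The orthogonal component v of w represents the same point p, since w and v
    differ by a vector of X.\<close>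
  obtain x v where xv: "w = x + v" "x \<in> X" and v: "\<And>y. y \<in> X \<Longrightarrow> orthogonal v y"
    using orthogonal_subspace_decomp_exists[of X w] X by (metis span_eq_iff)
  have "v \<notin> X" using w(1) xv X by (metis subspace_add)
  have "w \<in> span (insert v X)" "v \<in> span (insert w X)"
    using xv span_add[OF span_base[of x] span_base[of v]] span_diff[OF span_base[of w] span_base[of x]]
    by auto
  then have "span (insert w X) = span (insert v X)"
    by (intro antisym span_minimal) (auto simp: span_base)
  then have p: "p = proj_class X v" using w(2) by (simp add: proj_class_def)
  have "act h v = v \<or> act h v = - v" if h: "h \<in> H" for h
  proof -
    have hG: "h \<in> carrier G" using h H by blast
    have hX: "act h ` X = X" unfolding X_def using h hG by (rule image_act_line_span)
    have "quotient_space (span (insert (act h v) X)) X = quotient_space (span (insert v X)) X"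
      using fixed[OF h] unfolding p image_proj_class[OF linear_act[OF hG]] hX
      by (simp add: proj_class_def)
    then have "span (insert (act h v) X) \<subseteq> span (insert v X)"
      by (rule quotient_space_eq_imp_subset[OF X]) (auto simp: span_base)
    then have "act h v \<in> span (insert v X)"
      by (meson insertI1 span_base subsetD)
    \<comment> \<open>As h fixes p, it keeps v in the span of v and X, so \<open>act h v\<close> is
      a multiple of v modulo X.\<close>
    then obtain c where c: "act h v - c *\<^sub>R v \<in> X"
      using X by (auto simp: span_insert) (metis span_eq_iff)
    have "orthogonal (act h v) y" if "y \<in> X" for y
    proof -
      obtain z where "z \<in> X" "y = act h z" using \<open>y \<in> X\<close> hX by blast
      then show ?thesis using v inner_act[OF hG] by (simp add: orthogonal_def)
    qed
    \<comment> \<open>The difference lies in X and is orthogonal to X, so it vanishes.\<close>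
    then have "orthogonal (act h v - c *\<^sub>R v) (act h v - c *\<^sub>R v)"
      using v c by (simp add: orthogonal_def inner_diff_left)
    then have hv: "act h v = c *\<^sub>R v" by (simp add: orthogonal_def)
    have "v \<noteq> 0" using \<open>v \<notin> X\<close> X subspace_0 by blast
    then have "c * c = 1" using inner_act[OF hG, of v v] by (simp add: hv)
    then have "c = 1 \<or> c = -1" by (metis power2_eq_1_iff power2_eq_square)
    then show ?thesis using hv by auto
  qed
  then have "v \<in> X" unfolding X_def using H by (intro eigenvector_in_line_span)
  with \<open>v \<notin> X\<close> show False by blast
qed

sublocale invariant_arrangement G act "action_arrangement G act"
  by unfold_locales (auto simp: action_arrangement_invariant, auto simp: action_arrangement_def line_span_def)

lemma line_span_stabilizer:
  assumes y: "y \<in> wonderful_model (action_arrangement G act)"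
  defines "H \<equiv> stabilizer G (model_action (action_arrangement G act) act) y"
  shows "line_span act H = UNIV"
proof (rule ccontr)
  assume *: "line_span act H \<noteq> UNIV"
  let ?A = "action_arrangement G act" and ?X = "line_span act H"
  interpret model: group_action G "wonderful_model ?A" "model_action ?A act"
    by (rule group_action_model_action)
  have H: "subgroup H G"
    unfolding H_def using y by (rule model.stabilizer_subgroup)
  then have "?X \<in> ?A"
    using * unfolding action_arrangement_def by blast
  then have X: "?X \<in> proper_intersections ?A"
    unfolding proper_intersections_def using * by (auto intro!: exI[of _ "{?X}"])
  have "y \<in> UNIV \<times> (\<Pi>\<^sub>E X \<in> proper_intersections ?A. proj_quotient_points X)"
    using y wonderful_model_subset_topspace topspace_model_ambient[OF subspace_member] by blast
  then have p: "snd y ?X \<in> proj_quotient_points ?X"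
    using X by (auto simp: PiE_iff)
  have "(`) ((`) (act h)) (snd y ?X) = snd y ?X" if h: "h \<in> H" for h
  proof -
    have hG: "h \<in> carrier G" using H h by (rule subgroup.mem_carrier)
    \<comment> \<open>Because h preserves X, the induced map does not mix the component at X with
      another one; as h fixes y, that component is a fixed point.\<close>
    have "act h -` ?X = ?X"
      using image_act_line_span[OF h hG] bij_act[OF hG] by (metis bij_is_inj inj_vimage_image_eq)
    moreover have "snd (induced_map ?A (act h) y) ?X = snd y ?X"
      using h y by (simp add: H_def stabilizer_def model_action_eq)
    ultimately show ?thesis
      using X by (simp add: induced_map_def case_prod_beta)
  qed
  with p show False
    using no_fixed_proj_quotient_point subgroup.subset[OF H] by blast
qed

theorem digitalization:
  assumes faithful: "\<And>g. g \<in> carrier G \<Longrightarrow> (\<And>x. act g x = x) \<Longrightarrow> g = \<one>"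
  shows "is_digitalization G act (action_arrangement G act)"
  unfolding is_digitalization_def
proof (intro conjI ballI)
  fix y assume y: "y \<in> wonderful_model (action_arrangement G act)"
  let ?H = "stabilizer G (model_action (action_arrangement G act) act) y"
  interpret model: group_action G "wonderful_model (action_arrangement G act)"
    "model_action (action_arrangement G act) act"
    by (rule group_action_model_action)
  have H: "subgroup ?H G"
    using y by (rule model.stabilizer_subgroup)
  \<comment> \<open>The line span of the stabilizer is the whole space, so
    \<open>h \<otimes> h\<close> acts trivially and is the unit by faithfulness.\<close>
  have square: "h \<otimes> h = \<one>" if h: "h \<in> ?H" for h
  proof (rule faithful)
    have hG: "h \<in> carrier G" using H h by (rule subgroup.mem_carrier)
    then show "h \<otimes> h \<in> carrier G" by simp
    show "act (h \<otimes> h) x = x" for x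
      using act_square_fixes_line_span[OF h hG] line_span_stabilizer[OF y] hG by (simp add: act_mult)
  qed
  interpret H: group "G\<lparr>carrier := ?H\<rparr>"
    using H by (rule subgroup.subgroup_is_group) (rule is_group)
  have "comm_group (G\<lparr>carrier := ?H\<rparr>)"
    using square by (intro H.comm_group_of_squares_one) simp
  then show "elementary_abelian_2_group (G\<lparr>carrier := ?H\<rparr>)"
    using square by (simp add: elementary_abelian_2_group_def)
qed (simp_all add: group_action_model_action continuous_map_model_action act_arrangement_complement
    model_action_model_embedding)

end

section \<open>Models of arrangements that differ by hyperplanes\<close>

lemma homeomorphic_map_model_projection:
  fixes A B :: "'v::euclidean_space set set"
  assumes A: "\<And>X. X \<in> A \<Longrightarrow> subspace X" and B: "\<And>X. X \<in> B \<Longrightarrow> subspace X"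
    and AB: "proper_intersections A \<subseteq> proper_intersections B"
    and hyperplane: "\<And>X. X \<in> proper_intersections B - proper_intersections A \<Longrightarrow> dim X + 1 = DIM('v)"
  shows "homeomorphic_map (model_ambient B) (model_ambient A) (model_projection A)"
proof -
  \<comment> \<open>The inverse of the projection: each forgotten factor has just one point,
    \<open>quotient_space UNIV X\<close>, which is put back.\<close>
  define s :: "'v \<times> ('v set \<Rightarrow> 'v set set) \<Rightarrow> 'v \<times> ('v set \<Rightarrow> 'v set set)" where
    "s = (\<lambda>(x, p). (x, \<lambda>X \<in> proper_intersections B.
      if X \<in> proper_intersections A then p X else quotient_space UNIV X))"
  have point: "proj_quotient_points X = {quotient_space UNIV X}"
    if "X \<in> proper_intersections B" "X \<notin> proper_intersections A" for X
    using that by (intro proj_quotient_points_hyperplane hyperplane) auto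
  have "continuous_map (model_ambient B) (model_ambient A) (model_projection A)"
    unfolding continuous_map_model_ambient_iff
    using AB continuous_map_model_ambient_fst[of B] continuous_map_model_ambient_component[of _ B]
    by (auto simp: model_projection_def case_prod_beta o_def)
  moreover have "continuous_map (model_ambient A) (model_ambient B) s"
    unfolding continuous_map_model_ambient_iff
  proof (intro conjI ballI)
    fix X assume X: "X \<in> proper_intersections B"
    show "continuous_map (model_ambient A) (proj_quotient X) (\<lambda>y. snd (s y) X)"
    proof (cases "X \<in> proper_intersections A")
      case True
      then show ?thesis
        using X continuous_map_model_ambient_component by (simp add: s_def case_prod_beta)
    next
      case False
      then show ?thesis
        using X point subspace_proper_intersection[OF B X]
        by (simp add: s_def case_prod_beta topspace_proj_quotient)
    qed
  qed (use continuous_map_model_ambient_fst[of A] in \<open>auto simp: s_def case_prod_beta o_def\<close>)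
  moreover have "s (model_projection A y) = y" if y: "y \<in> topspace (model_ambient B)" for y
  proof -
    obtain x p where xp: "y = (x, p)" and p: "p \<in> (\<Pi>\<^sub>E X \<in> proper_intersections B. proj_quotient_points X)"
      using y B by (auto simp: topspace_model_ambient)
    have "(\<lambda>X \<in> proper_intersections B. if X \<in> proper_intersections A then p X else quotient_space UNIV X) = p"
      using p point by (intro extensionalityI[of _ "proper_intersections B"]) (auto simp: PiE_iff)
    then show ?thesis
      unfolding xp s_def model_projection_def
      by (simp cong: restrict_cong if_cong)
  qed
  moreover have "model_projection A (s y) = y" if y: "y \<in> topspace (model_ambient A)" for y
  proof -
    obtain x p where xp: "y = (x, p)" and p: "p \<in> extensional (proper_intersections A)"
      using y A by (auto simp: topspace_model_ambient PiE_def)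
    show ?thesis
      using p AB unfolding xp s_def model_projection_def
      by (auto intro!: extensionalityI[of _ "proper_intersections A"])
  qed
  ultimately show ?thesis
    by (auto simp: homeomorphic_map_maps homeomorphic_maps_def)
qed

lemma model_projection_model_embedding:
  assumes "proper_intersections A \<subseteq> proper_intersections B"
  shows "model_projection A (model_embedding B x) = model_embedding A x"
  using assms by (auto simp: model_projection_def model_embedding_def restrict_restrict Int_absorb1)

text \<open>By continuity the embedded complement lies in the closure of the embedded dense part. It
  is applied to the complement of the larger arrangement, which may be strictly smaller.\<close>

lemma closure_model_embedding_dense:
  fixes A :: "'v::euclidean_space set set"
  assumes A: "\<And>X. X \<in> A \<Longrightarrow> subspace X"
    and D: "D \<subseteq> arrangement_complement A" "closure D = UNIV"
  shows "model_ambient A closure_of (model_embedding A ` D) = wonderful_model A"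
proof
  let ?C = "arrangement_complement A"
  show "model_ambient A closure_of (model_embedding A ` D) \<subseteq> wonderful_model A"
    unfolding wonderful_model_def using D(1) by (intro closure_of_mono image_mono)
  have "top_of_set ?C closure_of D = ?C"
    using D by (auto simp: closure_of_subtopology Int_absorb1)
  then have "model_embedding A ` ?C \<subseteq> model_ambient A closure_of (model_embedding A ` D)"
    using continuous_map_image_closure_subset[OF continuous_map_model_embedding, of A D] A by simp
  then show "wonderful_model A \<subseteq> model_ambient A closure_of (model_embedding A ` D)"
    unfolding wonderful_model_def by (intro closure_of_minimal) auto
qed

theorem models_coincide_of_hyperplanes:
  fixes A B :: "'v::euclidean_space set set"
  assumes "invariant_arrangement G act A" and "invariant_arrangement G act B"
    and B: "finite B" "UNIV \<notin> B" and "UNIV \<notin> A"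
    and AB: "proper_intersections A \<subseteq> proper_intersections B"
    and hyperplane: "\<And>X. X \<in> proper_intersections B - proper_intersections A \<Longrightarrow> dim X + 1 = DIM('v)"
  shows "models_coincide G act A B"
proof -
  interpret A: invariant_arrangement G act A by fact
  interpret B: invariant_arrangement G act B by fact
  have homeo: "homeomorphic_map (model_ambient B) (model_ambient A) (model_projection A)"
    using A.subspace_member B.subspace_member AB hyperplane by (rule homeomorphic_map_model_projection)
  have "\<Union> A \<subseteq> \<Union> B"
    using Union_proper_intersections[OF \<open>UNIV \<notin> A\<close>] Union_proper_intersections[OF B(2)] AB by blast
  then have sub: "arrangement_complement B \<subseteq> arrangement_complement A"
    unfolding arrangement_complement_def by blast
  \<comment> \<open>A homeomorphism commutes with closures, so only the images of the embedded
    complements have to be compared.\<close>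
  have "model_projection A ` wonderful_model B
      = model_ambient A closure_of (model_projection A ` model_embedding B ` arrangement_complement B)"
    unfolding wonderful_model_def
    using homeomorphic_map_closure_of[OF homeo]
      continuous_map_image_subset_topspace[OF continuous_map_model_embedding[OF B.subspace_member]]
    by simp
  also have "\<dots> = model_ambient A closure_of (model_embedding A ` arrangement_complement B)"
    using AB by (simp add: image_image model_projection_model_embedding)
  also have "\<dots> = wonderful_model A"
    using A.subspace_member sub closure_arrangement_complement[OF B(1) B.subspace_member B(2)]
    by (rule closure_model_embedding_dense)
  finally have image: "model_projection A ` wonderful_model B = wonderful_model A" .
  have "model_projection A (model_action B act g y) = model_action A act g (model_projection A y)"
    if g: "g \<in> carrier G" and y: "y \<in> wonderful_model B" for g y
  proof -
    \<comment> \<open>At an index X of A, both sides use the component at the preimage of X, which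
      is an index of A too and hence not forgotten.\<close>
    have "model_projection A (induced_map B (act g) y) = induced_map A (act g) (model_projection A y)"
      using AB A.vimage_proper_intersection[OF g]
      by (auto simp: model_projection_def induced_map_def case_prod_beta intro!: restrict_ext
          extensionalityI[of _ "proper_intersections A"])
    then show ?thesis
      using y image by (simp add: A.model_action_eq B.model_action_eq flip: image)
  qed
  then show ?thesis
    unfolding models_coincide_def
    using AB homeo image B.induced_map_wonderful_model by (simp add: B.model_action_eq)
qed

section \<open>The symmetric group and the braid arrangement\<close>

lemma carrier_BijGroup_UNIV: "carrier (BijGroup UNIV) = {f. bij f}"
  by (auto simp: BijGroup_def Bij_def)

lemma mult_BijGroup_UNIV: "bij f \<Longrightarrow> bij g \<Longrightarrow> f \<otimes>\<^bsub>BijGroup UNIV\<^esub> g = f \<circ> g"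
  by (auto simp: BijGroup_def Bij_def compose_def)

lemma one_BijGroup_UNIV: "\<one>\<^bsub>BijGroup UNIV\<^esub> = id"
  by (auto simp: BijGroup_def)

text \<open>Evaluation at \<open>s i\<close> keeps the inverse of s out of later
  computations.\<close>

lemma permute_coords_nth: "bij s \<Longrightarrow> permute_coords s x $ s i = x $ i"
  by (simp add: permute_coords_def bij_is_inj)

lemma orthogonal_group_action_permute_coords:
  "orthogonal_group_action (BijGroup (UNIV :: 'n::finite set)) permute_coords"
proof -
  interpret group "BijGroup (UNIV :: 'n set)" by (rule group_BijGroup)
  show ?thesis
  proof (intro orthogonal_group_action.intro linear_group_action.intro is_group
      linear_group_action_axioms.intro orthogonal_group_action_axioms.intro)
    fix s assume "s \<in> carrier (BijGroup (UNIV :: 'n set))"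
    then have s: "bij s" by (simp add: carrier_BijGroup_UNIV)
    show "linear (permute_coords s)"
      by (auto intro!: linearI simp: permute_coords_def vec_eq_iff)
    show "permute_coords s x \<bullet> permute_coords s y = x \<bullet> y" for x y
      using sum.reindex_bij_betw[OF bij_imp_bij_inv[OF s], of "\<lambda>i. x $ i * y $ i"]
      by (simp add: permute_coords_def inner_vec_def)
  qed (auto simp: permute_coords_def one_BijGroup_UNIV carrier_BijGroup_UNIV mult_BijGroup_UNIV
      o_inv_distrib vec_eq_iff)
qed

interpretation permute: orthogonal_group_action "BijGroup (UNIV :: 'n::finite set)" permute_coords
  by (rule orthogonal_group_action_permute_coords)

lemma permute_coords_faithful:
  assumes s: "bij (s :: 'n::finite \<Rightarrow> 'n)" and fixed: "\<And>x. permute_coords s x = x"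
  shows "s = id"
proof
  fix i
  \<comment> \<open>The entry at \<open>s i\<close> of the permuted unit vector is its old entry at
    i; as the vector is fixed, this entry is 1.\<close>
  have "axis (s i) (1::real) $ i = 1"
    using permute_coords_nth[OF s, of "axis (s i) 1" i] fixed by simp
  then show "s i = id i" by (simp add: axis_def split: if_splits)
qed

lemma permute_coords_square_eq_iff:
  assumes s: "bij s"
  shows "permute_coords s (permute_coords s x) = x \<longleftrightarrow> (\<forall>i. x $ s (s i) = x $ i)"
proof
  assume "permute_coords s (permute_coords s x) = x"
  then show "\<forall>i. x $ s (s i) = x $ i"
    by (metis permute_coords_nth[OF s])
next
  assume *: "\<forall>i. x $ s (s i) = x $ i"
  have "permute_coords s (permute_coords s x) $ j = x $ j" for j
  proof -
    obtain i where "j = s (s i)" using s by (metis bij_pointE)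
    then show ?thesis using * by (simp add: permute_coords_nth[OF s])
  qed
  then show "permute_coords s (permute_coords s x) = x" by (simp add: vec_eq_iff)
qed

lemma line_span_permute_coords:
  assumes "subgroup H (BijGroup (UNIV :: 'n::finite set))"
  shows "line_span permute_coords H = {x. \<forall>h\<in>H. \<forall>i. x $ h (h i) = x $ i}"
proof -
  have "bij h" if "h \<in> H" for h
    using subgroup.mem_carrier[OF assms that] by (simp add: carrier_BijGroup_UNIV)
  then show ?thesis
    using permute.line_span_eq_fixed_by_squares[OF assms] by (simp add: permute_coords_square_eq_iff)
qed

section \<open>Braid hyperplanes and braid spaces\<close>

lemma mem_braid_space: "x \<in> braid_space P \<longleftrightarrow> (\<forall>B\<in>P. \<forall>i\<in>B. \<forall>j\<in>B. x $ i = x $ j)"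
  unfolding braid_space_def braid_hyperplane_def by blast

lemma subspace_braid_hyperplane: "subspace (braid_hyperplane i j)"
  by (auto simp: braid_hyperplane_def subspace_def)

lemma braid_hyperplane_neq_UNIV:
  assumes "i \<noteq> j"
  shows "braid_hyperplane i j \<noteq> UNIV"
proof
  assume "braid_hyperplane i j = UNIV"
  then have "axis i 1 \<in> braid_hyperplane i j" by simp
  then show False using assms by (simp add: braid_hyperplane_def axis_def)
qed

lemma dim_braid_hyperplane:
  fixes i j :: "'n::finite"
  assumes "i \<noteq> j"
  shows "dim (braid_hyperplane i j) = CARD('n) - 1"
proof -
  have "braid_hyperplane i j = {x. (axis i 1 - axis j 1) \<bullet> x = 0}"
    by (auto simp: braid_hyperplane_def inner_diff_left inner_axis')
  moreover have "axis i (1::real) \<noteq> axis j 1"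
    using assms by (simp add: axis_eq_axis)
  ultimately show ?thesis
    by (simp add: dim_hyperplane)
qed

lemma dim_two_braid_hyperplanes:
  fixes a b c d :: "'n::finite"
  assumes "a \<noteq> b" "c \<noteq> d" "{a, b} \<noteq> {c, d}"
  shows "dim (braid_hyperplane a b \<inter> braid_hyperplane c d) + 2 \<le> CARD('n)"
proof -
  obtain e where "e \<in> {c, d}" "e \<notin> {a, b}"
    using assms by blast
  \<comment> \<open>This unit vector vanishes at a and b but separates c from d, so the second
    hyperplane cuts the dimension once more.\<close>
  then have "axis e 1 \<in> braid_hyperplane a b - braid_hyperplane c d"
    using assms by (auto simp: braid_hyperplane_def axis_def)
  then have "dim (braid_hyperplane a b \<inter> braid_hyperplane c d) < dim (braid_hyperplane a b)"
    by (intro dim_psubset)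
      (auto simp: subspace_inter subspace_braid_hyperplane span_eq_iff[THEN iffD2])
  then show ?thesis
    using dim_braid_hyperplane[OF assms(1)] by linarith
qed

text \<open>The blocks are the classes of indices whose coordinates agree throughout X. The
  criterion applies to any intersection of sets given by coordinate equalities.\<close>

lemma braid_spaceI:
  fixes X :: "(real^'n::finite) set"
  assumes "\<And>x. (\<And>i j. (\<And>y. y \<in> X \<Longrightarrow> y $ i = y $ j) \<Longrightarrow> x $ i = x $ j) \<Longrightarrow> x \<in> X"
  obtains P where "partition_on UNIV P" "X = braid_space P"
proof
  let ?E = "{(i, j). \<forall>y\<in>X. y $ i = y $ j}"
  have "equiv UNIV ?E"
    by (auto intro!: equivI simp: refl_on_def sym_def trans_def)
  then show "partition_on UNIV (UNIV // ?E)"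
    by (rule partition_on_quotient)
  show "X = braid_space (UNIV // ?E)"
  proof (intro equalityI subsetI)
    fix x assume "x \<in> X"
    then show "x \<in> braid_space (UNIV // ?E)"
      unfolding mem_braid_space by (auto elim!: quotientE)
  next
    fix x assume x: "x \<in> braid_space (UNIV // ?E)"
    show "x \<in> X"
    proof (rule assms)
      fix i j assume "\<And>y. y \<in> X \<Longrightarrow> y $ i = y $ j"
      then have i: "i \<in> ?E `` {i}" and j: "j \<in> ?E `` {i}" by auto
      have "?E `` {i} \<in> UNIV // ?E"
        by (rule quotientI) simp
      from bspec[OF bspec[OF bspec[OF x[unfolded mem_braid_space] this] i] j]
      show "x $ i = x $ j" .
    qed
  qed
qed

section \<open>Members of the arrangement of the symmetric group and their intersections\<close>

lemma symmetric_arrangementI: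
  assumes s: "bij s" and ij: "i \<noteq> j"
    and sub: "{x :: real^'n::finite. \<forall>k. x $ s (s k) = x $ k} \<subseteq> braid_hyperplane i j"
  shows "{x. \<forall>k. x $ s (s k) = x $ k} \<in> symmetric_arrangement"
proof -
  let ?H = "generate (BijGroup UNIV) {s}"
  have "s \<in> carrier (BijGroup UNIV)" using s by (simp add: carrier_BijGroup_UNIV)
  then have "line_span permute_coords ?H = {x. \<forall>k. x $ s (s k) = x $ k}" "subgroup ?H (BijGroup UNIV)"
    using permute.line_span_cyclic permute_coords_square_eq_iff[OF s]
    by (auto intro: permute.generate_is_subgroup)
  moreover have "{x :: real^'n. \<forall>k. x $ s (s k) = x $ k} \<noteq> UNIV"
    using sub braid_hyperplane_neq_UNIV[OF ij] by auto
  ultimately show ?thesis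
    unfolding symmetric_arrangement_def action_arrangement_def by blast
qed

text \<open>No hyperplane occurs: if the square of h moves i, it also moves \<open>h i\<close>, and
  the equations obtained from i and from \<open>h i\<close> concern different pairs of
  coordinates.\<close>

lemma symmetric_arrangement_codim:
  fixes U :: "(real^'n::finite) set"
  assumes "U \<in> symmetric_arrangement"
  shows "dim U + 2 \<le> CARD('n)"
proof -
  obtain H where H: "subgroup H (BijGroup (UNIV :: 'n set))" "U = line_span permute_coords H" "U \<noteq> UNIV"
    using assms unfolding symmetric_arrangement_def action_arrangement_def by blast
  have U: "U = {x. \<forall>h\<in>H. \<forall>i. x $ h (h i) = x $ i}"
    using H by (simp add: line_span_permute_coords)
  obtain h i where h: "h \<in> H" "h (h i) \<noteq> i"
    using H(3) U by force
  have "inj h"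
    using subgroup.mem_carrier[OF H(1) h(1)] by (simp add: carrier_BijGroup_UNIV bij_is_inj)
  moreover have "h i \<noteq> i"
    using h(2) by metis
  ultimately have ne: "h i \<noteq> i" "h (h (h i)) \<noteq> h i" "h (h (h i)) \<noteq> h (h i)"
    using h(2) by (simp_all add: inj_eq)
  have sub: "U \<subseteq> braid_hyperplane (h (h i)) i \<inter> braid_hyperplane (h (h (h i))) (h i)"
    using h(1) by (auto simp: U braid_hyperplane_def)
  have "{h (h i), i} \<noteq> {h (h (h i)), h i}"
    using h(2) ne by (auto simp: doubleton_eq_iff)
  then show ?thesis
    using dim_two_braid_hyperplanes[OF h(2) ne(2)] dim_subset[OF sub] by linarith
qed

text \<open>Each equation defining a braid space of codimension at least 2 is implied by a member of
  the arrangement containing that space. A third index in the block gives a 3-cycle; otherwise a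
  second nontrivial block gives a 4-cycle.\<close>

lemma symmetric_arrangement_separates:
  fixes P :: "'n::finite set set"
  assumes P: "partition_on UNIV P" "dim (braid_space P) + 2 \<le> CARD('n)"
    and B: "B \<in> P" "i \<in> B" "j \<in> B" "i \<noteq> j"
  obtains U where "U \<in> symmetric_arrangement" "braid_space P \<subseteq> U" "U \<subseteq> braid_hyperplane i j"
proof (cases "B = {i, j}")
  case False
  then obtain k where k: "k \<in> B" "k \<noteq> i" "k \<noteq> j" using B by blast
  \<comment> \<open>The 3-cycle \<open>(i j k)\<close>; its square is again a 3-cycle, so it forces
    all three coordinates to agree.\<close>
  define s where "s = Transposition.transpose i j \<circ> Transposition.transpose j k"
  have s: "bij s" by (simp add: s_def bij_comp)
  have [simp]: "s i = j" "s j = k" "s k = i" "\<And>m. m \<notin> {i, j, k} \<Longrightarrow> s m = m"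
    using k B(4) by (auto simp: s_def transpose_def)
  have "{x :: real^'n. \<forall>k. x $ s (s k) = x $ k} \<subseteq> braid_hyperplane i j"
  proof
    fix x :: "real^'n" assume "x \<in> {x. \<forall>k. x $ s (s k) = x $ k}"
    then have "x $ s (s i) = x $ i" "x $ s (s k) = x $ k" by blast+
    then show "x \<in> braid_hyperplane i j" by (simp add: braid_hyperplane_def)
  qed
  moreover have "x $ s (s m) = x $ m" if "x \<in> braid_space P" for x :: "real^'n" and m
  proof -
    have "x $ i = x $ j" "x $ j = x $ k"
      using that B k unfolding mem_braid_space by blast+
    then show ?thesis by (cases "m \<in> {i, j, k}") auto
  qed
  ultimately show ?thesis
    using symmetric_arrangementI[OF s B(4)] that by blast
next
  case True
  \<comment> \<open>If all other blocks were singletons, the braid space would contain a hyperplane,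
    against codimension 2.\<close>
  have "\<exists>C\<in>P. \<exists>c\<in>C. \<exists>d\<in>C. c \<noteq> d \<and> C \<noteq> B"
  proof (rule ccontr)
    assume "\<not> ?thesis"
    then have "braid_hyperplane i j \<subseteq> braid_space P"
      using True unfolding mem_braid_space subset_iff braid_hyperplane_def by force
    from dim_subset[OF this] show False
      using dim_braid_hyperplane[OF B(4)] P(2) by linarith
  qed
  then obtain C c d where C: "C \<in> P" "c \<in> C" "d \<in> C" "c \<noteq> d" "C \<noteq> B" by blast
  have "C \<inter> B = {}"
    using P(1) C B by (meson disjointD partition_onD2)
  then have cd: "c \<noteq> i" "c \<noteq> j" "d \<noteq> i" "d \<noteq> j" using C True by auto
  \<comment> \<open>The 4-cycle \<open>(i c j d)\<close>; its square exchanges i with j and c with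
    d.\<close>
  define s where "s = Transposition.transpose i c \<circ> Transposition.transpose c j \<circ> Transposition.transpose j d"
  have s: "bij s" by (simp add: s_def bij_comp)
  have [simp]: "s i = c" "s c = j" "s j = d" "s d = i" "\<And>m. m \<notin> {i, j, c, d} \<Longrightarrow> s m = m"
    using cd C(4) B(4) by (auto simp: s_def transpose_def)
  have "{x :: real^'n. \<forall>k. x $ s (s k) = x $ k} \<subseteq> braid_hyperplane i j"
  proof
    fix x :: "real^'n" assume "x \<in> {x. \<forall>k. x $ s (s k) = x $ k}"
    then have "x $ s (s i) = x $ i" by blast
    then show "x \<in> braid_hyperplane i j" by (simp add: braid_hyperplane_def)
  qed
  moreover have "x $ s (s m) = x $ m" if "x \<in> braid_space P" for x :: "real^'n" and m
  proof -
    have "x $ i = x $ j" "x $ c = x $ d"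
      using that B C unfolding mem_braid_space by blast+
    then show ?thesis by (cases "m \<in> {i, j, c, d}") auto
  qed
  ultimately show ?thesis
    using symmetric_arrangementI[OF s B(4)] that by blast
qed

theorem proper_intersections_symmetric_arrangement:
  "proper_intersections (symmetric_arrangement :: (real^'n::finite) set set) = rank2_truncation"
proof (intro equalityI subsetI)
  fix X :: "(real^'n) set" assume X: "X \<in> proper_intersections symmetric_arrangement"
  then obtain C where C: "C \<subseteq> symmetric_arrangement" "X = \<Inter> C"
    unfolding proper_intersections_def by blast
  obtain U where U: "U \<in> symmetric_arrangement" "X \<subseteq> U"
    using X by (rule proper_intersection_subset_member)
  then have "dim X + 2 \<le> CARD('n)"
    using symmetric_arrangement_codim[OF U(1)] dim_subset[OF U(2)] by linarith
  moreover obtain P where "partition_on UNIV P" "X = braid_space P"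
  proof (rule braid_spaceI[of X])
    fix x :: "real^'n" assume x: "\<And>i j. (\<And>y. y \<in> X \<Longrightarrow> y $ i = y $ j) \<Longrightarrow> x $ i = x $ j"
    have "x \<in> V" if V: "V \<in> C" for V
    proof -
      obtain H where "subgroup H (BijGroup (UNIV :: 'n set))" "V = line_span permute_coords H"
        using C(1) V unfolding symmetric_arrangement_def action_arrangement_def by blast
      then have "V = {x. \<forall>h\<in>H. \<forall>i. x $ h (h i) = x $ i}"
        by (simp add: line_span_permute_coords)
      then show ?thesis
        using x C(2) V by blast
    qed
    then show "x \<in> X" using C(2) by blast
  qed
  ultimately show "X \<in> rank2_truncation"
    unfolding rank2_truncation_def by blast
next
  fix X :: "(real^'n) set" assume "X \<in> rank2_truncation"
  then obtain P where P: "partition_on UNIV P" "dim (braid_space P) + 2 \<le> CARD('n)" "X = braid_space P"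
    unfolding rank2_truncation_def by blast
  \<comment> \<open>All members above X are taken; among them is one inside each hyperplane that
    defines X.\<close>
  let ?C = "{U \<in> symmetric_arrangement. X \<subseteq> U}"
  have "\<Inter> ?C \<subseteq> X"
  proof
    fix x assume x: "x \<in> \<Inter> ?C"
    have "x $ i = x $ j" if B: "B \<in> P" "i \<in> B" "j \<in> B" for B i j
    proof (cases "i = j")
      case False
      then obtain U where "U \<in> symmetric_arrangement" "braid_space P \<subseteq> U" "U \<subseteq> braid_hyperplane i j"
        using symmetric_arrangement_separates[OF P(1,2) B] by blast
      then have "x \<in> braid_hyperplane i j"
        using x P(3) by blast
      then show ?thesis by (simp add: braid_hyperplane_def)
    qed simp
    then show "x \<in> X" unfolding P(3) mem_braid_space by blast
  qed
  then have "X = \<Inter> ?C" by blast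
  moreover have "X \<noteq> UNIV" using P(2,3) by (auto simp: dim_UNIV)
  ultimately show "X \<in> proper_intersections symmetric_arrangement"
    unfolding proper_intersections_def by blast
qed

section \<open>Comparison with the braid arrangement\<close>

lemma invariant_arrangement_braid:
  "invariant_arrangement (BijGroup (UNIV :: 'n::finite set)) permute_coords braid_arrangement"
proof
  fix X :: "(real^'n) set" assume "X \<in> braid_arrangement"
  then obtain i j where ij: "X = braid_hyperplane i j" "i \<noteq> j"
    unfolding braid_arrangement_def by blast
  then show "subspace X" by (simp add: subspace_braid_hyperplane)
  fix s assume s: "s \<in> carrier (BijGroup (UNIV :: 'n set))"
  then have bij: "bij s" by (simp add: carrier_BijGroup_UNIV)
  have "permute_coords s ` X = braid_hyperplane (s i) (s j)"
  proof (intro equalityI subsetI)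
    fix y assume "y \<in> permute_coords s ` X"
    then show "y \<in> braid_hyperplane (s i) (s j)"
      by (auto simp: ij braid_hyperplane_def permute_coords_nth[OF bij])
  next
    fix y assume y: "y \<in> braid_hyperplane (s i) (s j)"
    obtain z where z: "y = permute_coords s z"
      using permute.bij_act[OF s] by (metis bij_pointE)
    with y have "z \<in> X"
      by (simp add: ij braid_hyperplane_def permute_coords_nth[OF bij])
    then show "y \<in> permute_coords s ` X" using z by blast
  qed
  moreover have "s i \<noteq> s j" using ij(2) bij by (auto dest: bij_is_inj injD)
  ultimately show "permute_coords s ` X \<in> braid_arrangement"
    unfolding braid_arrangement_def by blast
qed

lemma proper_intersection_braid_arrangement_cases:
  fixes X :: "(real^'n::finite) set"
  assumes "X \<in> proper_intersections braid_arrangement"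
  shows "X \<in> rank2_truncation \<or> dim X + 1 = CARD('n)"
proof -
  obtain C where C: "C \<subseteq> braid_arrangement" "X = \<Inter> C" "X \<noteq> UNIV"
    using assms unfolding proper_intersections_def by blast
  obtain P where P: "partition_on UNIV P" "X = braid_space P"
  proof (rule braid_spaceI[of X])
    fix x :: "real^'n" assume x: "\<And>i j. (\<And>y. y \<in> X \<Longrightarrow> y $ i = y $ j) \<Longrightarrow> x $ i = x $ j"
    have "x \<in> V" if V: "V \<in> C" for V
    proof -
      obtain i j where ij: "V = braid_hyperplane i j"
        using C(1) V unfolding braid_arrangement_def by blast
      then have "y $ i = y $ j" if "y \<in> X" for y
        using that C(2) V by (auto simp: braid_hyperplane_def)
      then have "x $ i = x $ j" by (rule x)
      then show ?thesis by (simp add: ij braid_hyperplane_def)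
    qed
    then show "x \<in> X" using C(2) by blast
  qed
  have "subspace X"
    unfolding P(2) braid_space_def by (auto intro!: subspace_Inter subspace_braid_hyperplane)
  then have "dim X \<noteq> CARD('n)"
    using C(3) by (metis DIM_cart DIM_real dim_eq_full mult.right_neutral span_eq_iff)
  then have "dim X < CARD('n)"
    using dim_subset_UNIV[of X] by simp
  then show ?thesis
    using P unfolding rank2_truncation_def by (cases "dim X + 2 \<le> CARD('n)") auto
qed

lemma rank2_truncation_subset_braid:
  "rank2_truncation \<subseteq> proper_intersections (braid_arrangement :: (real^'n::finite) set set)"
proof
  fix X :: "(real^'n) set" assume "X \<in> rank2_truncation"
  then obtain P where P: "dim X + 2 \<le> CARD('n)" "X = braid_space P"
    unfolding rank2_truncation_def by blast
  \<comment> \<open>Equal indices, allowed in \<open>braid_space\<close>, are left out: they give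
    the whole space, which is not in the arrangement.\<close>
  let ?C = "{braid_hyperplane i j |i j. i \<noteq> j \<and> (\<exists>B\<in>P. i \<in> B \<and> j \<in> B)}"
  have "X = \<Inter> ?C"
  proof (intro equalityI subsetI)
    fix x assume "x \<in> X"
    then show "x \<in> \<Inter> ?C"
      unfolding P(2) mem_braid_space by (auto simp: braid_hyperplane_def)
  next
    fix x assume x: "x \<in> \<Inter> ?C"
    have "x $ i = x $ j" if "B \<in> P" "i \<in> B" "j \<in> B" for B i j
    proof (cases "i = j")
      case False
      then have "braid_hyperplane i j \<in> ?C" using that by blast
      then show ?thesis using x by (auto simp: braid_hyperplane_def)
    qed simp
    then show "x \<in> X"
      unfolding P(2) mem_braid_space by blast
  qed
  moreover have "?C \<subseteq> braid_arrangement"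
    unfolding braid_arrangement_def by blast
  moreover have "X \<noteq> UNIV" using P(1) by (auto simp: dim_UNIV)
  ultimately show "X \<in> proper_intersections braid_arrangement"
    unfolding proper_intersections_def by blast
qed

theorem theorem4p1:
  shows "proper_intersections (symmetric_arrangement :: (real^'n::finite) set set) = rank2_truncation
    \<and> is_digitalization (BijGroup (UNIV :: 'n set)) permute_coords symmetric_arrangement
    \<and> models_coincide (BijGroup (UNIV :: 'n set)) permute_coords
        symmetric_arrangement braid_arrangement"
proof (intro conjI)
  show rank2: "proper_intersections (symmetric_arrangement :: (real^'n) set set) = rank2_truncation"
    by (rule proper_intersections_symmetric_arrangement)
  show "is_digitalization (BijGroup (UNIV :: 'n set)) permute_coords symmetric_arrangement"
    unfolding symmetric_arrangement_def
    by (rule permute.digitalization)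
      (simp add: carrier_BijGroup_UNIV one_BijGroup_UNIV permute_coords_faithful)
  show "models_coincide (BijGroup (UNIV :: 'n set)) permute_coords
      symmetric_arrangement braid_arrangement"
  proof (rule models_coincide_of_hyperplanes)
    show "invariant_arrangement (BijGroup (UNIV :: 'n set)) permute_coords symmetric_arrangement"
      unfolding symmetric_arrangement_def by (rule permute.invariant_arrangement_axioms)
    have "braid_arrangement \<subseteq> (\<lambda>(i, j). braid_hyperplane i j) ` (UNIV :: ('n \<times> 'n) set)"
      unfolding braid_arrangement_def by auto
    then show "finite (braid_arrangement :: (real^'n) set set)"
      by (rule finite_subset) simp
    show "UNIV \<notin> (braid_arrangement :: (real^'n) set set)"
      unfolding braid_arrangement_def using braid_hyperplane_neq_UNIV by blast
    show "UNIV \<notin> (symmetric_arrangement :: (real^'n) set set)"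
      unfolding symmetric_arrangement_def action_arrangement_def by blast
    \<comment> \<open>An intersection outside the rank 2 truncation can only be a hyperplane, so its
      factor is a single point.\<close>
    show "dim X + 1 = DIM(real^'n)"
      if "X \<in> proper_intersections braid_arrangement - proper_intersections symmetric_arrangement"
      for X :: "(real^'n) set"
      using that proper_intersection_braid_arrangement_cases rank2 by auto
  qed (simp_all add: invariant_arrangement_braid rank2 rank2_truncation_subset_braid)
qed

end
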